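(* Let $k\ge 4$. For all $n\in\mathbb{N}$ we have $$ c_{(k-2)kn}=C_{n,(k-1)^2,1},\qquad c_{(k-2)(kn+1)}=C_{n,(k-1)^2,k-1}. $$
   Context: $\mathbb{N}$ denotes the nonnegative integers. The $(m,d)$-Catalan number is $C_{n,m,d}=\frac{d}{(m-1)n+d}\binom{mn+d-1}{n}$. For fixed $k$, $c_N$ ($N\ge 0$) is the number of proper $k$-partitions of a convex $(N+2)$-gon $P$, drawn with a horizontal edge at the top, whose vertices are colored counterclockwise with the sequence $1,2,\ldots,k,1,2,\ldots,k,\ldots$, starting at the left endpoint of the top edge. A $k$-partition of $P$ is a set of chords between vertices of $P$, no two crossing in the interior of $P$, such that all bounded regions are $k$-gons with vertices among those of $P$. It is proper if every $k$-gon contains all $k$ colors among its vertices. By convention, a polygon with $2$ vertices is a single edge and has exactly one proper $k$-partition, so $c_0=1$. *)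

theory Defs
  imports Complex_Main
begin

text \<open>
  The vertices of a convex polygon with \<open>n\<close> vertices are numbered \<open>0, \<dots>, n - 1\<close> counterclockwise,
  starting at the left endpoint of the top edge. A nonempty set \<open>W\<close> of these vertices stands for the
  convex polygon that it spans; its cyclic order is the one induced by \<open>0 < 1 < \<dots> < n - 1\<close>.
  A segment is represented by the set of its two endpoints.
\<close>

definition sides :: "nat set \<Rightarrow> nat set set" where
  "sides W = {{a, b} | a b. a \<in> W \<and> b \<in> W \<and> a < b \<and>
     ((\<forall>w\<in>W. \<not> (a < w \<and> w < b)) \<or> (\<forall>w\<in>W. a \<le> w \<and> w \<le> b))}"

definition diagonals :: "nat set \<Rightarrow> nat set set" where
  "diagonals W = {{a, b} | a b. a \<in> W \<and> b \<in> W \<and> a \<noteq> b} - sides W"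

text \<open>
  Two segments between vertices of a convex polygon meet in the interior of both of them
  iff their endpoints alternate in the cyclic order.
\<close>

definition crossing :: "nat set \<Rightarrow> nat set \<Rightarrow> bool" where
  "crossing e f \<longleftrightarrow> (\<exists>a b c d. a < c \<and> c < b \<and> b < d \<and>
     ((e = {a, b} \<and> f = {c, d}) \<or> (e = {c, d} \<and> f = {a, b})))"

text \<open>
  For a set \<open>D\<close> of pairwise noncrossing diagonals, every bounded region of the drawing is a convex
  polygon, given here by its vertex set: its sides are drawn (as sides of the big polygon or as
  elements of \<open>D\<close>) and no element of \<open>D\<close> cuts through it. As the elements of \<open>D\<close> do not cross the
  sides of the region, such a cut could only be a diagonal of the region.
\<close>

definition regions :: "nat \<Rightarrow> nat set set \<Rightarrow> nat set set" where
  "regions n D = {W. W \<subseteq> {..<n} \<and> 3 \<le> card W \<and>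
     sides W \<subseteq> sides {..<n} \<union> D \<and> diagonals W \<inter> D = {}}"

text \<open>
  Sides of the polygon are always drawn, so the chords of a partition are diagonals. The polygon
  with 2 vertices has no diagonals and no regions; the empty set is its only \<open>k\<close>-partition.
\<close>

definition k_partition :: "nat \<Rightarrow> nat \<Rightarrow> nat set set \<Rightarrow> bool" where
  "k_partition k n D \<longleftrightarrow> D \<subseteq> diagonals {..<n} \<and>
     (\<forall>e\<in>D. \<forall>f\<in>D. \<not> crossing e f) \<and> (\<forall>W\<in>regions n D. card W = k)"

definition color :: "nat \<Rightarrow> nat \<Rightarrow> nat" where
  "color k v = v mod k + 1"

definition proper_k_partition :: "nat \<Rightarrow> nat \<Rightarrow> nat set set \<Rightarrow> bool" where
  "proper_k_partition k n D \<longleftrightarrow> k_partition k n D \<and> (\<forall>W\<in>regions n D. {1..k} \<subseteq> color k ` W)"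

definition num_proper_partitions :: "nat \<Rightarrow> nat \<Rightarrow> nat" where
  "num_proper_partitions k N = card {D. proper_k_partition k (N + 2) D}"

text \<open>The subtraction in the binomial coefficient is on naturals; it is only meant for \<open>d \<ge> 1\<close>.\<close>

definition Catalan :: "nat \<Rightarrow> nat \<Rightarrow> nat \<Rightarrow> real" where
  "Catalan n m d =
     real d / ((real m - 1) * real n + real d) * real ((m * n + d - 1) choose n)"

end

theory Submission
  imports Defs "HOL-Library.FuncSet" "HOL-Computational_Algebra.Formal_Power_Series"
begin

text \<open>
  Remove from a dissected polygon the \<open>k\<close>-gon that lies at its top edge. What is left is a sequence of
  \<open>k - 1\<close> smaller dissected polygons, one below each of the other sides of this \<open>k\<close>-gon, and they can be
  chosen independently of each other (\<open>bij_betw_glue_dissections\<close>). A side whose endpoints differ by \<open>g\<close>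
  carries a polygon with \<open>g + 1\<close> vertices. Starting the colors at another residue only permutes
  them, so the number of proper dissections is a function \<open>c g\<close> of this gap alone, with \<open>c 1 = 1\<close> and
  \[c(g) = \sum c(g_1) \cdots c(g_{k-1}) \quad (g \ge 2).\]
  The sum is over the compositions of \<open>g\<close> whose \<open>k\<close> partial sums are distinct modulo \<open>k\<close>,
  which is what it means for the top \<open>k\<close>-gon to have all colors (\<open>num_dissections_0_rec\<close>).

  The point is that only gaps congruent to \<open>1\<close> or \<open>-1\<close> modulo \<open>k\<close> can contribute. Suppose this for
  smaller gaps. The top \<open>k\<close>-gon then steps through all residues modulo \<open>k\<close> by steps \<open>1\<close> and \<open>-1\<close>
  without repeating one, so it can never turn around: all its gaps are \<open>1\<close>, or all are \<open>-1\<close>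
  (\<open>rainbow_gaps_uniform\<close>). As there are \<open>k - 1\<close> of them, their sum is \<open>-1\<close> in the first case and
  \<open>1\<close> in the second. More precisely, with \<open>s = (k - 2) k\<close>, the contributing gaps are of the form
  \<open>s n + 1\<close> and \<open>s n + (k - 1)\<close>; this closes up because \<open>(k - 1)\<^sup>2 = s + 1\<close>.

  Let \<open>A\<close> and \<open>B\<close> be the generating functions of \<open>c (s n + 1)\<close> and \<open>c (s n + k - 1)\<close>, the two sequences
  of the theorem. The recursion becomes \<open>B = A ^ (k - 1)\<close> and \<open>A = 1 + x B ^ (k - 1)\<close>, so
  \<open>A = 1 + x A ^ m\<close> with \<open>m = (k - 1)\<^sup>2\<close>. The coefficients of all powers of \<open>A\<close> follow from
  \<open>A ^ (d + 1) = A ^ d + x A ^ (m + d)\<close>, because the \<open>(m, d)\<close>-Catalan numbers satisfy the same recursion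
  (\<open>fps_power_eq_Catalan\<close>).
\<close>

section \<open>The face at the base of a system of noncrossing chords\<close>

text \<open>
  A segment is now the ordered pair of its endpoints, and the polygon is spanned by an arbitrary
  interval of vertices, as the parts of a dissection are. Its sides and its base \<open>(a, b)\<close> are included,
  so that the base of a part is at the same time a chord of the whole.
\<close>

definition chord_systems :: "nat \<Rightarrow> nat \<Rightarrow> (nat \<times> nat) set set" where
  "chord_systems a b = {E. E \<subseteq> {(u, v). a \<le> u \<and> u < v \<and> v \<le> b} \<and> (a, b) \<in> E \<and>
     (\<forall>u. a \<le> u \<and> u < b \<longrightarrow> (u, Suc u) \<in> E) \<and>
     (\<forall>u v x y. (u, v) \<in> E \<longrightarrow> (x, y) \<in> E \<longrightarrow> \<not> (u < x \<and> x < v \<and> v < y))}"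

definition is_side :: "nat set \<Rightarrow> nat \<Rightarrow> nat \<Rightarrow> bool" where
  "is_side W u v \<longleftrightarrow> (\<forall>w\<in>W. \<not> (u < w \<and> w < v)) \<or> (\<forall>w\<in>W. u \<le> w \<and> w \<le> v)"

definition faces :: "(nat \<times> nat) set \<Rightarrow> nat set set" where
  "faces E = {W. finite W \<and> 3 \<le> card W \<and>
     (\<forall>u\<in>W. \<forall>v\<in>W. u < v \<longrightarrow> ((u, v) \<in> E \<longleftrightarrow> is_side W u v))}"

definition uncovered :: "nat \<Rightarrow> nat \<Rightarrow> (nat \<times> nat) set \<Rightarrow> nat set" where
  "uncovered a b E = {w. a \<le> w \<and> w \<le> b \<and> (\<forall>u v. (u, v) \<in> E \<longrightarrow> u < w \<longrightarrow> w < v \<longrightarrow> (u, v) = (a, b))}"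

lemma chord_systemsD:
  assumes "E \<in> chord_systems a b"
  shows "(u, v) \<in> E \<Longrightarrow> a \<le> u \<and> u < v \<and> v \<le> b"
    and "(a, b) \<in> E"
    and "a \<le> u \<Longrightarrow> u < b \<Longrightarrow> (u, Suc u) \<in> E"
    and "(u, v) \<in> E \<Longrightarrow> (x, y) \<in> E \<Longrightarrow> u < x \<Longrightarrow> x < v \<Longrightarrow> v < y \<Longrightarrow> False"
  using assms unfolding chord_systems_def by fast+

lemma finite_chord_systems: "finite (chord_systems a b)"
proof (rule finite_subset)
  show "chord_systems a b \<subseteq> Pow ({a..b} \<times> {a..b})"
    unfolding chord_systems_def by auto
qed simp

lemma obtain_gap:
  fixes W :: "nat set"
  assumes "finite W" "a \<in> W" "b \<in> W" "a \<le> x" "x < b"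
  obtains u v where "u \<in> W" "v \<in> W" "u \<le> x" "x < v" "\<And>w. w \<in> W \<Longrightarrow> w \<le> u \<or> v \<le> w"
proof -
  define u where "u = Max {w \<in> W. w \<le> x}"
  define v where "v = Min {w \<in> W. x < w}"
  have "u \<in> {w \<in> W. w \<le> x}"
    unfolding u_def using assms by (intro Max_in) auto
  moreover have "v \<in> {w \<in> W. x < w}"
    unfolding v_def using assms by (intro Min_in) auto
  moreover have "w \<le> u \<or> v \<le> w" if "w \<in> W" for w
  proof (cases "w \<le> x")
    case True
    then show ?thesis unfolding u_def using that assms by (auto intro!: Max_ge)
  next
    case False
    then show ?thesis unfolding v_def using that assms by (auto intro!: Min_le)
  qed
  ultimately show ?thesis using that by blast
qed

lemma face_side:
  assumes "W \<in> faces E" "u \<in> W" "v \<in> W" "u < v"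
  shows "(u, v) \<in> E \<longleftrightarrow> is_side W u v"
  using assms unfolding faces_def by blast

lemma faceD:
  assumes "W \<in> faces E"
  shows "finite W" "3 \<le> card W" "W \<noteq> {}"
  using assms unfolding faces_def by auto

text \<open>
  No chord other than the base can pass over a vertex of the face at the base: such a chord would
  cross a side of the face unless both its ends are vertices of the face, and then it would be a
  diagonal of the face. Conversely, a vertex outside of the face lies below one of its sides.
\<close>

lemma root_face_unique:
  assumes E: "E \<in> chord_systems a b" and W: "W \<in> faces E" and ab: "a \<in> W" "b \<in> W"
    and bounds: "\<And>w. w \<in> W \<Longrightarrow> a \<le> w \<and> w \<le> b"
  shows "W = uncovered a b E"
proof (intro equalityI subsetI)
  fix w
  assume w: "w \<in> W"
  have "(x, y) = (a, b)" if xy: "(x, y) \<in> E" "x < w" "w < y" for x y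
  proof -
    have xyb: "a \<le> x" "x < y" "y \<le> b"
      using chord_systemsD(1)[OF E xy(1)] by auto
    have "x \<in> W"
    proof -
      obtain u v where uv: "u \<in> W" "v \<in> W" "u \<le> x" "x < v" "\<And>z. z \<in> W \<Longrightarrow> z \<le> u \<or> v \<le> z"
        using obtain_gap[OF faceD(1)[OF W] ab xyb(1) less_le_trans[OF xyb(2,3)]] by blast
      have "v \<le> w" using uv(5)[OF w] uv xy by linarith
      have "(u, v) \<in> E"
        using face_side[OF W uv(1,2)] uv unfolding is_side_def by fastforce
      then have "\<not> u < x"
        using chord_systemsD(4)[OF E _ xy(1)] uv \<open>v \<le> w\<close> xy by (meson le_less_trans)
      then have "u = x" using uv by simp
      then show ?thesis using uv by simp
    qed
    moreover have "y \<in> W"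
    proof -
      have y1: "a \<le> y - 1" "y - 1 < b" using xyb by auto
      obtain u v where uv: "u \<in> W" "v \<in> W" "u \<le> y - 1" "y - 1 < v" "\<And>z. z \<in> W \<Longrightarrow> z \<le> u \<or> v \<le> z"
        using obtain_gap[OF faceD(1)[OF W] ab, of "y - 1"] xyb by (metis y1)
      have "w \<le> u" using uv(5)[OF w] uv xy by linarith
      have e: "(u, v) \<in> E"
        using face_side[OF W uv(1,2)] uv unfolding is_side_def by fastforce
      have "\<not> y < v"
        using chord_systemsD(4)[OF E xy(1) e] uv(3) \<open>w \<le> u\<close> xy xyb by fastforce
      then have "v = y" using uv by linarith
      then show ?thesis using uv by simp
    qed
    ultimately have "is_side W x y"
      using face_side[OF W] xyb xy by blast
    then show ?thesis
      using xy w ab xyb unfolding is_side_def by (metis le_antisym)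
  qed
  then show "w \<in> uncovered a b E"
    unfolding uncovered_def using bounds[OF w] by blast
next
  fix w
  assume w: "w \<in> uncovered a b E"
  show "w \<in> W"
  proof (rule ccontr)
    assume "w \<notin> W"
    then have wb: "a \<le> w" "w < b" using w ab unfolding uncovered_def by (auto simp: le_less)
    then obtain u v where uv: "u \<in> W" "v \<in> W" "u \<le> w" "w < v" "\<And>z. z \<in> W \<Longrightarrow> z \<le> u \<or> v \<le> z"
      using obtain_gap[OF faceD(1)[OF W] ab wb] by blast
    have e: "(u, v) \<in> E"
      using face_side[OF W uv(1,2)] uv unfolding is_side_def by fastforce
    have "u < w" using uv \<open>w \<notin> W\<close> by (metis le_less)
    then have "(u, v) = (a, b)" using w e uv unfolding uncovered_def by blast
    then have "W \<subseteq> {a, b}" using uv(5) bounds by force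
    then have "card W \<le> card {a, b}" by (intro card_mono) auto
    also have "\<dots> \<le> 2" by (simp add: card_insert_if)
    finally show False using faceD[OF W] by simp
  qed
qed

text \<open>
  From an uncovered vertex, the longest chord to the right other than the base ends in an uncovered
  vertex again, because a chord over its end would cross it, be longer, or cover the first vertex, too. So the
  uncovered vertices are joined by chords into a path from \<open>a\<close> to \<open>b\<close>, and the face at the base is the
  region between the base and this path.
\<close>

lemma root_face:
  assumes E: "E \<in> chord_systems a b" and ab: "Suc a < b"
  shows "uncovered a b E \<in> faces E"
proof -
  let ?U = "uncovered a b E"
  have U_ab: "a \<in> ?U" "b \<in> ?U"
    using ab chord_systemsD(1)[OF E] unfolding uncovered_def by fastforce+
  have finU: "finite ?U"
    by (rule finite_subset[of _ "{a..b}"]) (auto simp: uncovered_def)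
  have finE: "finite E"
    by (rule finite_subset[of _ "{a..b} \<times> {a..b}"]) (use chord_systemsD(1)[OF E] in fastforce)+
  have jump: "\<exists>y\<in>?U. (u, y) \<in> E \<and> (u, y) \<noteq> (a, b) \<and> u < y" if u: "u \<in> ?U" "u < b" for u
  proof -
    define Y where "Y = {y. (u, y) \<in> E \<and> (u, y) \<noteq> (a, b)}"
    have "Y \<subseteq> {a..b}"
      using chord_systemsD(1)[OF E] by (fastforce simp: Y_def)
    then have "finite Y"
      by (rule finite_subset) simp
    moreover have "Suc u \<in> Y"
      using chord_systemsD(3)[OF E] u ab unfolding Y_def uncovered_def by auto
    ultimately have Y: "Max Y \<in> Y" "\<And>y. y \<in> Y \<Longrightarrow> y \<le> Max Y"
      by (auto intro: Max_in)
    define y where "y = Max Y"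
    have y: "(u, y) \<in> E" "(u, y) \<noteq> (a, b)" "\<And>z. (u, z) \<in> E \<Longrightarrow> (u, z) \<noteq> (a, b) \<Longrightarrow> z \<le> y"
      using Y unfolding y_def Y_def by auto
    have uy: "a \<le> u" "u < y" "y \<le> b" using chord_systemsD(1)[OF E y(1)] by auto
    have "(p, q) = (a, b)" if pq: "(p, q) \<in> E" "p < y" "y < q" for p q
    proof (rule ccontr)
      assume ne: "(p, q) \<noteq> (a, b)"
      have "\<not> p < u" using u pq ne uy unfolding uncovered_def by fastforce
      moreover have "\<not> u < p" using chord_systemsD(4)[OF E y(1) pq(1)] pq by blast
      ultimately have "p = u" by simp
      then show False using y(3)[of q] pq ne by auto
    qed
    then have "y \<in> ?U" unfolding uncovered_def using uy by auto
    then show ?thesis using y uy by blast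
  qed
  obtain y where y: "y \<in> ?U" "(a, y) \<noteq> (a, b)" "a < y"
    using jump[OF U_ab(1)] ab by auto
  have "card {a, y, b} \<le> card ?U"
    using U_ab y finU by (intro card_mono) auto
  moreover have "card {a, y, b} = 3"
    using y ab by auto
  ultimately have card: "3 \<le> card ?U" by simp
  have "(u, v) \<in> E \<longleftrightarrow> is_side ?U u v" if uv: "u \<in> ?U" "v \<in> ?U" "u < v" for u v
  proof
    assume e: "(u, v) \<in> E"
    show "is_side ?U u v"
      unfolding is_side_def using e unfolding uncovered_def by blast
  next
    assume "is_side ?U u v"
    then consider "\<forall>w\<in>?U. \<not> (u < w \<and> w < v)" | "\<forall>w\<in>?U. u \<le> w \<and> w \<le> v"
      unfolding is_side_def by blast
    then show "(u, v) \<in> E"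
    proof cases
      case 1
      have "u < b" using uv unfolding uncovered_def by auto
      then obtain z where z: "z \<in> ?U" "(u, z) \<in> E" "(u, z) \<noteq> (a, b)" "u < z"
        using jump uv(1) by blast
      then have "v \<le> z" using 1 by force
      moreover have "\<not> v < z" using uv(2) z uv(3) unfolding uncovered_def by blast
      ultimately show ?thesis using z by simp
    next
      case 2
      then have "u \<le> a" "b \<le> v" using U_ab by auto
      then have "u = a" "v = b" using uv unfolding uncovered_def by auto
      then show ?thesis using chord_systemsD(2)[OF E] by simp
    qed
  qed
  then show ?thesis unfolding faces_def using finU card by blast
qed

section \<open>Splitting along the face at the base\<close>

definition restrict_chords :: "nat \<Rightarrow> nat \<Rightarrow> (nat \<times> nat) set \<Rightarrow> (nat \<times> nat) set" where
  "restrict_chords u v E = {(x, y). (x, y) \<in> E \<and> u \<le> x \<and> y \<le> v}"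

text \<open>
  The face at the base has the vertices \<open>p 0 < \<dots> < p K\<close>, and \<open>f i\<close> is drawn below its side from \<open>p i\<close>
  to \<open>p (Suc i)\<close>. This side need not be added: it is the base of \<open>f i\<close>.
\<close>

definition glue :: "(nat \<Rightarrow> nat) \<Rightarrow> nat \<Rightarrow> (nat \<Rightarrow> (nat \<times> nat) set) \<Rightarrow> (nat \<times> nat) set" where
  "glue p K f = insert (p 0, p K) (\<Union>i<K. f i)"

lemma face_base:
  assumes W: "W \<in> faces E"
  shows "(Min W, Max W) \<in> E" "Min W \<in> W" "Max W \<in> W" "W \<subseteq> {Min W..Max W}"
proof -
  show m: "Min W \<in> W" "Max W \<in> W" and sub: "W \<subseteq> {Min W..Max W}"
    using faceD[OF W] by auto
  have "Min W < Max W"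
  proof (rule ccontr)
    assume "\<not> Min W < Max W"
    then have "W \<subseteq> {Min W}" using sub by auto
    then have "card W \<le> 1" using card_mono[of "{Min W}" W] by simp
    then show False using faceD(2)[OF W] by simp
  qed
  moreover have "is_side W (Min W) (Max W)"
    unfolding is_side_def using sub by auto
  ultimately show "(Min W, Max W) \<in> E"
    using face_side[OF W m] by blast
qed

text \<open>
  The longest side of a face is itself a chord, so a face of the restricted system cannot leave
  the interval; inside it, both systems have the same chords.
\<close>

lemma faces_restrict_chords: "W \<in> faces (restrict_chords u v E) \<longleftrightarrow> W \<in> faces E \<and> W \<subseteq> {u..v}"
proof
  assume W: "W \<in> faces (restrict_chords u v E)"
  have sub: "W \<subseteq> {u..v}"
    using face_base(1,4)[OF W] unfolding restrict_chords_def by auto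
  then have "(x, y) \<in> restrict_chords u v E \<longleftrightarrow> (x, y) \<in> E" if "x \<in> W" "y \<in> W" for x y
    using that unfolding restrict_chords_def by auto
  then show "W \<in> faces E \<and> W \<subseteq> {u..v}"
    using W sub unfolding faces_def by simp
next
  assume W: "W \<in> faces E \<and> W \<subseteq> {u..v}"
  then have "(x, y) \<in> restrict_chords u v E \<longleftrightarrow> (x, y) \<in> E" if "x \<in> W" "y \<in> W" for x y
    using that unfolding restrict_chords_def by auto
  then show "W \<in> faces (restrict_chords u v E)"
    using W unfolding faces_def by simp
qed

lemma path_less:
  fixes p :: "nat \<Rightarrow> nat"
  assumes p: "\<And>i. i < K \<Longrightarrow> p i < p (Suc i)" and "i < j" "j \<le> K"
  shows "p i < p j"
  using assms(2,3)
proof (induction j)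
  case (Suc j)
  then show ?case using p[of j] by (cases "i = j") (auto intro: less_trans)
qed simp

lemma path_le:
  fixes p :: "nat \<Rightarrow> nat"
  assumes p: "\<And>i. i < K \<Longrightarrow> p i < p (Suc i)" and "i \<le> j" "j \<le> K"
  shows "p i \<le> p j"
  using path_less[of K p, OF p, of i j] assms(2,3) by (cases "i = j") auto

lemma path_index:
  fixes p :: "nat \<Rightarrow> nat"
  assumes "p 0 \<le> x" "x < p K"
  obtains i where "i < K" "p i \<le> x" "x < p (Suc i)"
proof -
  define j where "j = (LEAST j. x < p j)"
  have j: "x < p j" "j \<le> K"
    unfolding j_def using assms(2) by (auto intro: LeastI Least_le)
  then obtain i where i: "j = Suc i"
    using assms(1) by (cases j) auto
  have "\<not> x < p i"
    using not_less_Least[of i "\<lambda>j. x < p j"] i unfolding j_def by simp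
  then show ?thesis using that[of i] i j by simp
qed

context
  fixes p :: "nat \<Rightarrow> nat" and K :: nat
  assumes p: "\<And>i. i < K \<Longrightarrow> p i < p (Suc i)" and K: "2 \<le> K"
begin

lemmas p_less = path_less[of K p, OF p]
lemmas p_le = path_le[of K p, OF p]

lemma gap_inside:
  assumes "i < K" "p i \<le> x" "x < y" "y \<le> p (Suc i)"
  shows "p 0 \<le> x" "y \<le> p K" "(x, y) \<noteq> (p 0, p K)"
proof -
  show "p 0 \<le> x" "y \<le> p K"
    using assms p_le[of 0 i] p_le[of "Suc i" K] by auto
  have "p 0 < p i \<or> p (Suc i) < p K"
    using assms(1) K p_less[of 0 i] p_less[of "Suc i" K] by (cases i) auto
  then show "(x, y) \<noteq> (p 0, p K)"
    using assms by auto
qed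

lemma same_gap:
  assumes "i < K" "j < K" "p i \<le> x" "x < y" "y \<le> p (Suc i)" "p j \<le> x'" "x' < y'" "y' \<le> p (Suc j)"
    and "x < y'" "x' < y"
  shows "i = j"
proof (rule ccontr)
  assume "i \<noteq> j"
  then have "Suc i \<le> j \<or> Suc j \<le> i" by auto
  then show False
    using assms p_le[of "Suc i" j] p_le[of "Suc j" i] by auto
qed

context
  fixes f :: "nat \<Rightarrow> (nat \<times> nat) set"
  assumes f: "\<And>i. i < K \<Longrightarrow> f i \<in> chord_systems (p i) (p (Suc i))"
begin

lemma glue_part:
  assumes "i < K" "(x, y) \<in> f i"
  shows "p i \<le> x" "x < y" "y \<le> p (Suc i)" "p 0 \<le> x" "y \<le> p K" "(x, y) \<noteq> (p 0, p K)"
  using chord_systemsD(1)[OF f[OF assms(1)] assms(2)] gap_inside[OF assms(1)] by blast+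

lemma glue_cases:
  assumes "(x, y) \<in> glue p K f"
  obtains "x = p 0" "y = p K" | i where "i < K" "(x, y) \<in> f i"
  using assms unfolding glue_def by auto

lemma glue_bounds:
  assumes "(x, y) \<in> glue p K f"
  shows "p 0 \<le> x" "x < y" "y \<le> p K"
  using assms p_less[of 0 K] K
  by (auto elim!: glue_cases dest: glue_part)

lemma glue_in_chord_systems: "glue p K f \<in> chord_systems (p 0) (p K)"
proof -
  have "(u, Suc u) \<in> glue p K f" if u: "p 0 \<le> u" "u < p K" for u
  proof -
    obtain i where i: "i < K" "p i \<le> u" "u < p (Suc i)"
      using path_index[of p u K] u by blast
    then show ?thesis
      using chord_systemsD(3)[OF f[OF i(1)] i(2,3)] unfolding glue_def by blast
  qed
  moreover have False
    if uv: "(u, v) \<in> glue p K f" and xy: "(x, y) \<in> glue p K f" and cross: "u < x" "x < v" "v < y"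
    for u v x y
  proof -
    note b = glue_bounds[OF uv] glue_bounds[OF xy]
    obtain i where i: "i < K" "(u, v) \<in> f i"
      using uv cross b by (auto elim!: glue_cases)
    obtain j where j: "j < K" "(x, y) \<in> f j"
      using xy cross b by (auto elim!: glue_cases)
    have "i = j"
      by (rule same_gap[OF i(1) j(1) glue_part(1-3)[OF i] glue_part(1-3)[OF j]]) (use cross b in auto)
    then show False
      using chord_systemsD(4)[OF f[OF i(1)] i(2) _ cross] j by blast
  qed
  moreover have "(p 0, p K) \<in> glue p K f" unfolding glue_def by blast
  moreover have "glue p K f \<subseteq> {(u, v). p 0 \<le> u \<and> u < v \<and> v \<le> p K}"
    using glue_bounds by auto
  ultimately show ?thesis unfolding chord_systems_def by blast
qed

text \<open>
  This recovers the path \<open>p\<close> from the glued system, and \<open>restrict_glue\<close> below recovers the parts, so that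
  gluing is injective.
\<close>

lemma uncovered_glue: "uncovered (p 0) (p K) (glue p K f) = p ` {..K}"
proof (intro equalityI subsetI)
  fix w assume w: "w \<in> uncovered (p 0) (p K) (glue p K f)"
  show "w \<in> p ` {..K}"
  proof (rule ccontr)
    assume nin: "w \<notin> p ` {..K}"
    then have "p 0 \<le> w" "w < p K" using w unfolding uncovered_def by (auto simp: le_less)
    then obtain i where i: "i < K" "p i \<le> w" "w < p (Suc i)"
      using path_index[of p w K] by blast
    then have "p i \<noteq> w" using nin by auto
    then have "p i < w" using i by simp
    moreover have e: "(p i, p (Suc i)) \<in> f i" using chord_systemsD(2)[OF f[OF i(1)]] .
    moreover have "(p i, p (Suc i)) \<in> glue p K f" using e i unfolding glue_def by blast
    ultimately show False
      using w i glue_part(6)[OF i(1) e] unfolding uncovered_def by blast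
  qed
next
  fix w assume "w \<in> p ` {..K}"
  then obtain j where j: "j \<le> K" "w = p j" by auto
  have "(u, v) = (p 0, p K)" if uv: "(u, v) \<in> glue p K f" "u < w" "w < v" for u v
    using uv(1)
  proof (cases rule: glue_cases)
    case (2 i)
    note g = glue_part[OF 2]
    have "\<not> j \<le> i" using p_le[of j i] 2 g uv j by auto
    moreover have "\<not> Suc i \<le> j" using p_le[of "Suc i" j] 2 g uv j by auto
    ultimately show ?thesis by simp
  qed auto
  moreover have "p 0 \<le> w" "w \<le> p K" using p_le[of 0 j] p_le[of j K] j by auto
  ultimately show "w \<in> uncovered (p 0) (p K) (glue p K f)"
    unfolding uncovered_def by blast
qed

lemma restrict_glue:
  assumes i: "i < K"
  shows "restrict_chords (p i) (p (Suc i)) (glue p K f) = f i"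
proof (intro equalityI subrelI)
  fix x y
  assume xy: "(x, y) \<in> f i"
  then show "(x, y) \<in> restrict_chords (p i) (p (Suc i)) (glue p K f)"
    using glue_part[OF i xy] i unfolding restrict_chords_def glue_def by auto
next
  fix x y
  assume "(x, y) \<in> restrict_chords (p i) (p (Suc i)) (glue p K f)"
  then have xy: "(x, y) \<in> glue p K f" and b: "p i \<le> x" "y \<le> p (Suc i)"
    unfolding restrict_chords_def by auto
  have "x < y" using glue_bounds[OF xy] by simp
  show "(x, y) \<in> f i"
    using xy
  proof (cases rule: glue_cases)
    case 1
    then show ?thesis using gap_inside(3)[OF i b(1) \<open>x < y\<close> b(2)] by simp
  next
    case (2 j)
    have "i = j"
      by (rule same_gap[OF i 2(1) b(1) \<open>x < y\<close> b(2) glue_part(1-3)[OF 2]]) (use \<open>x < y\<close> in auto)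
    then show ?thesis using 2 by simp
  qed
qed

text \<open>
  The longest side of a face decides where the face is: if it is the base, the face is the one
  at the base; otherwise it belongs to one part, and the whole face does.
\<close>

lemma faces_glue: "faces (glue p K f) = insert (p ` {..K}) (\<Union>i<K. faces (f i))"
proof -
  have sub: "W \<in> faces (glue p K f)" if "i < K" "W \<in> faces (f i)" for i W
    using that(2) faces_restrict_chords[of _ "p i" "p (Suc i)" "glue p K f"] restrict_glue[OF that(1)] by auto
  have "Suc (p 0) < p K" using p_less[of 0 1] p_less[of 1 K] K by auto
  then have "p ` {..K} \<in> faces (glue p K f)"
    using root_face[OF glue_in_chord_systems] uncovered_glue by simp
  moreover have "W = p ` {..K} \<or> (\<exists>i<K. W \<in> faces (f i))" if W: "W \<in> faces (glue p K f)" for W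
    using face_base(1)[OF W]
  proof (cases rule: glue_cases)
    case 1
    then have "p 0 \<in> W" "p K \<in> W" "W \<subseteq> {p 0..p K}"
      using face_base(2,3,4)[OF W] by simp_all
    then have "W = uncovered (p 0) (p K) (glue p K f)"
      by (intro root_face_unique[OF glue_in_chord_systems W]) auto
    then show ?thesis using uncovered_glue by simp
  next
    case (2 i)
    then have "W \<subseteq> {p i..p (Suc i)}"
      using glue_part[OF 2] face_base(4)[OF W] by auto
    then have "W \<in> faces (f i)"
      using faces_restrict_chords[of W "p i" "p (Suc i)" "glue p K f"] W restrict_glue[OF 2(1)] by simp
    then show ?thesis using 2 by blast
  qed
  ultimately show ?thesis using sub by blast
qed

end

text \<open>
  A chord other than the base lies between two consecutive path vertices, because no path vertex is
  covered by it. So nothing is lost by restricting to the parts.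
\<close>

lemma chord_system_decompose:
  assumes E: "E \<in> chord_systems (p 0) (p K)" and U: "uncovered (p 0) (p K) E = p ` {..K}"
  shows "i < K \<Longrightarrow> restrict_chords (p i) (p (Suc i)) E \<in> chord_systems (p i) (p (Suc i))"
    and "glue p K (\<lambda>i. restrict_chords (p i) (p (Suc i)) E) = E"
proof -
  have "Suc (p 0) < p K" using p_less[of 0 1] p_less[of 1 K] K by auto
  then have face: "p ` {..K} \<in> faces E"
    using root_face[OF E] U by simp
  show "restrict_chords (p i) (p (Suc i)) E \<in> chord_systems (p i) (p (Suc i))" if i: "i < K" for i
  proof -
    have "is_side (p ` {..K}) (p i) (p (Suc i))"
    proof -
      have "\<not> (p i < p j \<and> p j < p (Suc i))" if "j \<le> K" for j
        using p_le[of j i] p_le[of "Suc i" j] i that by (cases "j \<le> i") auto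
      then show ?thesis unfolding is_side_def by blast
    qed
    then have "(p i, p (Suc i)) \<in> E"
      using face_side[OF face, of "p i" "p (Suc i)"] p[OF i] i by auto
    moreover have "(u, Suc u) \<in> E" if "p i \<le> u" "u < p (Suc i)" for u
      by (rule chord_systemsD(3)[OF E]) (use gap_inside[OF i that(1), of "Suc u"] that in auto)
    ultimately show ?thesis
      using chord_systemsD(1)[OF E] chord_systemsD(4)[OF E] unfolding chord_systems_def restrict_chords_def
      by auto
  qed
  have "\<exists>i<K. p i \<le> x \<and> y \<le> p (Suc i)" if xy: "(x, y) \<in> E" "(x, y) \<noteq> (p 0, p K)" for x y
  proof -
    have b: "p 0 \<le> x" "x < y" "y \<le> p K" using chord_systemsD(1)[OF E xy(1)] by auto
    obtain i where i: "i < K" "p i \<le> x" "x < p (Suc i)"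
      using path_index[of p x K] b by auto
    have "p (Suc i) \<in> uncovered (p 0) (p K) E" using i U by auto
    then have "\<not> p (Suc i) < y" using xy i unfolding uncovered_def by blast
    then show ?thesis using i by auto
  qed
  then show "glue p K (\<lambda>i. restrict_chords (p i) (p (Suc i)) E) = E"
    using chord_systemsD(2)[OF E] unfolding glue_def restrict_chords_def by auto
qed

end

definition dissections :: "(nat set \<Rightarrow> bool) \<Rightarrow> nat \<Rightarrow> nat \<Rightarrow> (nat \<times> nat) set set" where
  "dissections Q a b = {E \<in> chord_systems a b. \<forall>W\<in>faces E. Q W}"

text \<open>
  A path from \<open>a\<close> to \<open>b\<close> is encoded by its list of gaps, that is, by a composition of \<open>b - a\<close>. This is
  the form in which powers of generating functions are expanded.
\<close>

definition vertices :: "nat \<Rightarrow> nat list \<Rightarrow> nat \<Rightarrow> nat" where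
  "vertices a gs i = a + sum_list (take i gs)"

lemma vertices_0: "vertices a gs 0 = a"
  by (simp add: vertices_def)

lemma vertices_Suc: "i < length gs \<Longrightarrow> vertices a gs (Suc i) = vertices a gs i + gs ! i"
  by (simp add: vertices_def take_Suc_conv_app_nth)

lemma vertices_length: "vertices a gs (length gs) = a + sum_list gs"
  by (simp add: vertices_def)

lemma vertices_step:
  assumes "0 \<notin> set gs" "i < length gs"
  shows "vertices a gs i < vertices a gs (Suc i)"
  using assms vertices_Suc[of i gs a] nth_mem[of i gs] by (cases "gs ! i") auto

definition gap_sequences :: "(nat set \<Rightarrow> bool) \<Rightarrow> nat \<Rightarrow> nat \<Rightarrow> nat list set" where
  "gap_sequences Q a b = {gs. 0 \<notin> set gs \<and> 2 \<le> length gs \<and> a + sum_list gs = b \<and>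
     Q (vertices a gs ` {..length gs})}"

lemma gap_sequencesD:
  assumes "gs \<in> gap_sequences Q a b"
  shows "i < length gs \<Longrightarrow> vertices a gs i < vertices a gs (Suc i)" "2 \<le> length gs"
    "a = vertices a gs 0" "b = vertices a gs (length gs)" "Q (vertices a gs ` {..length gs})"
  using assms vertices_step[of gs] by (auto simp: gap_sequences_def vertices_0 vertices_length)

lemma vertices_of_set:
  assumes "finite W" "W \<noteq> {}"
  obtains gs where "0 \<notin> set gs" "length gs = card W - 1" "vertices (Min W) gs ` {..length gs} = W"
    "Min W + sum_list gs = Max W"
proof -
  define ps where "ps = sorted_list_of_set W"
  have len: "length ps = card W" and set: "set ps = W"
    unfolding ps_def using assms by auto
  have W: "card W > 0" using assms by (simp add: card_gt_0_iff)
  have sorted: "ps ! i < ps ! j" if "i < j" "j < card W" for i j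
    using that len strict_sorted_list_of_set[of W]
    unfolding ps_def[symmetric] by (auto simp: sorted_wrt_iff_nth_less)
  define gs where "gs = map (\<lambda>i. ps ! Suc i - ps ! i) [0..<card W - 1]"
  have len_gs: "length gs = card W - 1" unfolding gs_def by simp
  have nth: "gs ! i = ps ! Suc i - ps ! i" if "i < length gs" for i
    using that unfolding gs_def by simp
  have le: "ps ! i \<le> ps ! j" if "i \<le> j" "j < card W" for i j
    using sorted[of i j] that by (cases "i = j") auto
  have ex: "\<exists>i<card W. w = ps ! i" if "w \<in> W" for w
    using that len set by (metis in_set_conv_nth)
  have "ps ! 0 = Min W"
  proof (rule Min_eqI[symmetric])
    show "ps ! 0 \<in> W" using W len set by (metis nth_mem)
    show "ps ! 0 \<le> w" if "w \<in> W" for w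
      using ex[OF that] le by auto
  qed (use assms in simp)
  have last: "ps ! (card W - 1) = Max W"
  proof (rule Max_eqI[symmetric])
    show "ps ! (card W - 1) \<in> W" using W len set by (metis nth_mem diff_less zero_less_one)
    show "w \<le> ps ! (card W - 1)" if "w \<in> W" for w
      using ex[OF that] le W by auto
  qed (use assms in simp)
  have v: "vertices (Min W) gs i = ps ! i" if "i \<le> length gs" for i
    using that
  proof (induction i)
    case (Suc i)
    then show ?case
      using le[of i "Suc i"] len_gs by (simp add: vertices_Suc nth)
  qed (simp add: vertices_0 \<open>ps ! 0 = Min W\<close>)
  have "gs ! i \<noteq> 0" if "i < length gs" for i
    using sorted[of i "Suc i"] nth[OF that] len_gs that by (simp add: less_diff_conv)
  then have "0 \<notin> set gs"
    by (auto simp: in_set_conv_nth)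
  moreover have "vertices (Min W) gs ` {..length gs} = W"
  proof -
    have "{..length gs} = {..<card W}" using len_gs W by auto
    then have "vertices (Min W) gs ` {..length gs} = (\<lambda>i. ps ! i) ` {..<length ps}"
      using v len by (intro image_cong) auto
    also have "\<dots> = set ps" by (auto simp: in_set_conv_nth)
    finally show ?thesis using set by simp
  qed
  moreover have "Min W + sum_list gs = Max W"
    using v[of "length gs"] last len_gs unfolding vertices_length by simp
  ultimately show ?thesis using that len_gs by blast
qed

lemma vertices_inject:
  assumes "0 \<notin> set gs" "0 \<notin> set hs"
    and eq: "vertices a gs ` {..length gs} = vertices a hs ` {..length hs}"
  shows "gs = hs"
proof -
  have sorted: "sorted_wrt (<) (map (vertices a xs) [0..<Suc (length xs)])" if "0 \<notin> set xs" for xs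
    unfolding sorted_wrt_map
    by (rule sorted_wrt_mono_rel[OF _ sorted_wrt_upt])
       (use path_less[of "length xs" "vertices a xs"] vertices_step[OF that] in auto)
  have "set (map (vertices a hs) [0..<Suc (length hs)]) = set (map (vertices a gs) [0..<Suc (length gs)])"
    using eq by (simp add: lessThan_Suc_atMost atLeast0LessThan del: upt_Suc)
  then have maps: "map (vertices a gs) [0..<Suc (length gs)] = map (vertices a hs) [0..<Suc (length hs)]"
    by (rule strict_sorted_equal[OF sorted[OF assms(1)] sorted[OF assms(2)], symmetric])
  from arg_cong[OF maps, of length] have len: "length gs = length hs"
    by simp
  have v: "vertices a gs i = vertices a hs i" if "i \<le> length gs" for i
    using arg_cong[OF maps, of "\<lambda>xs. xs ! i"] that len by (simp del: upt_Suc)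
  show ?thesis
  proof (rule nth_equalityI[OF len])
    fix i assume "i < length gs"
    then show "gs ! i = hs ! i"
      using v[of i] v[of "Suc i"] len by (simp add: vertices_Suc)
  qed
qed

text \<open>
  The bijection behind the recursion. The condition \<open>Q\<close> on the faces is arbitrary, since the faces of the
  whole are those of the parts and the one at the base. A single edge is excluded, for it has no face.
\<close>

lemma bij_betw_glue_dissections:
  assumes ab: "Suc a < b"
  shows "bij_betw (\<lambda>(gs, f). glue (vertices a gs) (length gs) f)
    (SIGMA gs:gap_sequences Q a b.
      \<Pi>\<^sub>E i\<in>{..<length gs}. dissections Q (vertices a gs i) (vertices a gs (Suc i)))
    (dissections Q a b)"
    (is "bij_betw ?G ?S _")
proof (rule bij_betw_imageI)
  have f_cs: "f i \<in> chord_systems (vertices a gs i) (vertices a gs (Suc i))"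
    if "(gs, f) \<in> ?S" "i < length gs" for gs f i
    using that unfolding dissections_def by (auto simp: PiE_def Pi_def)
  show "inj_on ?G ?S"
  proof (rule inj_onI, clarsimp simp only: prod.case)
    fix gs f hs h
    assume gs: "gs \<in> gap_sequences Q a b" and hs: "hs \<in> gap_sequences Q a b"
      and f: "f \<in> (\<Pi>\<^sub>E i\<in>{..<length gs}. dissections Q (vertices a gs i) (vertices a gs (Suc i)))"
      and h: "h \<in> (\<Pi>\<^sub>E i\<in>{..<length hs}. dissections Q (vertices a hs i) (vertices a hs (Suc i)))"
      and eq: "glue (vertices a gs) (length gs) f = glue (vertices a hs) (length hs) h"
    note fcs = f_cs[OF SigmaI, OF gs f] and hcs = f_cs[OF SigmaI, OF hs h]
    have "vertices a gs ` {..length gs} = uncovered a b (glue (vertices a gs) (length gs) f)"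
      using uncovered_glue[where p="vertices a gs" and f=f, OF gap_sequencesD(1,2)[OF gs] fcs] gap_sequencesD(3,4)[OF gs] by simp
    moreover have "vertices a hs ` {..length hs} = uncovered a b (glue (vertices a hs) (length hs) h)"
      using uncovered_glue[where p="vertices a hs" and f=h, OF gap_sequencesD(1,2)[OF hs] hcs] gap_sequencesD(3,4)[OF hs] by simp
    ultimately have "gs = hs"
      using eq vertices_inject[of gs hs a] gs hs unfolding gap_sequences_def by simp
    moreover have "f = h"
    proof (rule PiE_ext[OF f])
      show "h \<in> (\<Pi>\<^sub>E i\<in>{..<length gs}. dissections Q (vertices a gs i) (vertices a gs (Suc i)))"
        using h \<open>gs = hs\<close> by simp
      fix i assume "i \<in> {..<length gs}"
      then show "f i = h i"
        using restrict_glue[where p="vertices a gs" and f=f, OF gap_sequencesD(1,2)[OF gs] fcs, of i]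
          restrict_glue[where p="vertices a hs" and f=h, OF gap_sequencesD(1,2)[OF hs] hcs, of i] eq \<open>gs = hs\<close> by simp
    qed
    ultimately show "gs = hs \<and> f = h" by blast
  qed
  show "?G ` ?S = dissections Q a b"
  proof (intro equalityI subsetI)
    fix E assume "E \<in> ?G ` ?S"
    then obtain gs f where S: "(gs, f) \<in> ?S" and E: "E = glue (vertices a gs) (length gs) f"
      by auto
    then have gs: "gs \<in> gap_sequences Q a b" by simp
    note g = gap_sequencesD[OF gs]
    have faces: "faces E = insert (vertices a gs ` {..length gs}) (\<Union>i<length gs. faces (f i))"
      unfolding E by (rule faces_glue[where p="vertices a gs" and f=f, OF g(1,2) f_cs[OF S]])
    have "E \<in> chord_systems a b"
      using glue_in_chord_systems[where p="vertices a gs" and f=f, OF g(1,2) f_cs[OF S]] g(3,4) E by simp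
    moreover have "Q W" if "W \<in> faces E" for W
      using that S g(5) unfolding faces
      by (auto simp: dissections_def PiE_def Pi_def)
    ultimately show "E \<in> dissections Q a b" unfolding dissections_def by blast
  next
    fix E assume "E \<in> dissections Q a b"
    then have E: "E \<in> chord_systems a b" and Q: "\<And>W. W \<in> faces E \<Longrightarrow> Q W"
      unfolding dissections_def by auto
    define U where "U = uncovered a b E"
    have face: "U \<in> faces E" unfolding U_def by (rule root_face[OF E ab])
    have "a \<in> U" "b \<in> U" "U \<subseteq> {a..b}"
      using chord_systemsD(1)[OF E] ab unfolding U_def uncovered_def by fastforce+
    then have min: "Min U = a" and max: "Max U = b"
      using faceD[OF face] by (auto intro!: Min_eqI Max_eqI)
    obtain gs where gs: "0 \<notin> set gs" "length gs = card U - 1" "vertices a gs ` {..length gs} = U"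
      "a + sum_list gs = b"
      using vertices_of_set[of U] faceD[OF face] unfolding min max by blast
    then have gap: "gs \<in> gap_sequences Q a b"
      using faceD[OF face] Q[OF face] unfolding gap_sequences_def by simp
    note g = gap_sequencesD[OF gap]
    define f where "f = (\<lambda>i\<in>{..<length gs}. restrict_chords (vertices a gs i) (vertices a gs (Suc i)) E)"
    have E': "E \<in> chord_systems (vertices a gs 0) (vertices a gs (length gs))"
      and U': "uncovered (vertices a gs 0) (vertices a gs (length gs)) E = vertices a gs ` {..length gs}"
      using E gs(3) g(3,4) unfolding U_def by simp_all
    note d = chord_system_decompose[where p="vertices a gs", OF g(1,2) E' U']
    have "f \<in> (\<Pi>\<^sub>E i\<in>{..<length gs}. dissections Q (vertices a gs i) (vertices a gs (Suc i)))"
      using d(1) Q faces_restrict_chords unfolding f_def dissections_def by auto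
    moreover have "glue (vertices a gs) (length gs) f = E"
    proof -
      have "glue (vertices a gs) (length gs) f
          = glue (vertices a gs) (length gs) (\<lambda>i. restrict_chords (vertices a gs i) (vertices a gs (Suc i)) E)"
        unfolding glue_def f_def by auto
      then show ?thesis using d(2) by simp
    qed
    ultimately show "E \<in> ?G ` ?S" using gap by force
  qed
qed

section \<open>The recursion for proper dissections\<close>

definition colorful :: "nat \<Rightarrow> nat set \<Rightarrow> bool" where
  "colorful k W \<longleftrightarrow> card W = k \<and> {1..k} \<subseteq> color k ` W"

definition num_dissections :: "nat \<Rightarrow> nat \<Rightarrow> nat \<Rightarrow> nat" where
  "num_dissections k a b = card (dissections (colorful k) a b)"

text \<open>
  The colors of the vertices of the face at the base are distinct iff the partial sums of the gaps
  are distinct modulo \<open>k\<close>; the start of the path does not matter for that.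
\<close>

definition rainbow_gaps :: "nat \<Rightarrow> nat \<Rightarrow> nat list set" where
  "rainbow_gaps k g = {gs. length gs = k - 1 \<and> 0 \<notin> set gs \<and> sum_list gs = g \<and>
     inj_on (\<lambda>i. sum_list (take i gs) mod k) {..<k}}"

lemma finite_dissections: "finite (dissections Q a b)"
  by (rule finite_subset[OF _ finite_chord_systems]) (auto simp: dissections_def)

lemma colorful_iff_inj_on:
  assumes k: "0 < k" and card: "card W = k"
  shows "colorful k W \<longleftrightarrow> inj_on (\<lambda>w. w mod k) W"
proof -
  have fin: "finite W" using k card card.infinite by fastforce
  have "colorful k W \<longleftrightarrow> {1..k} \<subseteq> Suc ` (\<lambda>w. w mod k) ` W"
    using card by (simp add: colorful_def color_def image_image)
  also have "\<dots> \<longleftrightarrow> {..<k} \<subseteq> (\<lambda>w. w mod k) ` W"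
  proof -
    have "{1..k} = Suc ` {..<k}" by (simp add: image_Suc_lessThan)
    then show ?thesis by (simp add: inj_image_subset_iff)
  qed
  also have "\<dots> \<longleftrightarrow> (\<lambda>w. w mod k) ` W = {..<k}"
    using k by auto
  also have "\<dots> \<longleftrightarrow> card ((\<lambda>w. w mod k) ` W) = card W"
  proof
    assume "(\<lambda>w. w mod k) ` W = {..<k}"
    then show "card ((\<lambda>w. w mod k) ` W) = card W" using card by simp
  next
    assume "card ((\<lambda>w. w mod k) ` W) = card W"
    then show "(\<lambda>w. w mod k) ` W = {..<k}"
      using card k by (intro card_subset_eq) auto
  qed
  also have "\<dots> \<longleftrightarrow> inj_on (\<lambda>w. w mod k) W"
    using fin by (auto intro: eq_card_imp_inj_on simp: card_image)
  finally show ?thesis .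
qed

lemma gap_sequences_colorful:
  assumes k: "3 \<le> k"
  shows "gap_sequences (colorful k) a b = {gs \<in> rainbow_gaps k (b - a). a + sum_list gs = b}"
proof -
  have "colorful k (vertices a gs ` {..length gs}) \<longleftrightarrow>
      length gs = k - 1 \<and> inj_on (\<lambda>i. sum_list (take i gs) mod k) {..<k}" if "0 \<notin> set gs" for gs
  proof -
    have "strict_mono_on {..length gs} (vertices a gs)"
      using path_less[of "length gs" "vertices a gs"] vertices_step[OF that]
      by (intro strict_mono_onI) auto
    then have inj: "inj_on (vertices a gs) {..length gs}"
      by (rule strict_mono_on_imp_inj_on)
    then have card: "card (vertices a gs ` {..length gs}) = Suc (length gs)"
      by (simp add: card_image)
    show ?thesis
    proof (cases "length gs = k - 1")
      case True
      then have "Suc (length gs) = k" using k by simp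
      then have "colorful k (vertices a gs ` {..length gs})
          \<longleftrightarrow> inj_on (\<lambda>w. w mod k) (vertices a gs ` {..length gs})"
        using card k by (intro colorful_iff_inj_on) auto
      also have "\<dots> \<longleftrightarrow> inj_on ((\<lambda>w. w mod k) \<circ> vertices a gs) {..length gs}"
        using inj by (simp add: comp_inj_on_iff)
      also have "\<dots> \<longleftrightarrow> inj_on (\<lambda>i. sum_list (take i gs) mod k) {..length gs}"
      proof -
        have "(a + x) mod k = (a + y) mod k \<longleftrightarrow> x mod k = y mod k" for x y
        proof -
          have "(a + x) mod k = (a + y) mod k \<longleftrightarrow> int (a + x) mod int k = int (a + y) mod int k"
            by (simp only: zmod_int[symmetric] of_nat_eq_iff)
          also have "\<dots> \<longleftrightarrow> int x mod int k = int y mod int k"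
            by (simp add: mod_eq_dvd_iff)
          finally show ?thesis by (simp only: zmod_int[symmetric] of_nat_eq_iff)
        qed
        then show ?thesis unfolding inj_on_def vertices_def by simp
      qed
      finally show ?thesis using True k by (simp add: lessThan_Suc_atMost[symmetric])
    next
      case False
      then show ?thesis using card k unfolding colorful_def by auto
    qed
  qed
  then show ?thesis
    using k unfolding gap_sequences_def rainbow_gaps_def by auto
qed

lemma finite_rainbow_gaps: "finite (rainbow_gaps k g)"
  by (rule finite_subset[OF _ natpermute_finite[of g "k - 1"]])
     (auto simp: rainbow_gaps_def natpermute_def)

lemma num_dissections_rec:
  assumes k: "3 \<le> k" and ab: "Suc a < b"
  shows "num_dissections k a b = (\<Sum>gs\<in>rainbow_gaps k (b - a).
    \<Prod>i<k - 1. num_dissections k (vertices a gs i) (vertices a gs (Suc i)))"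
proof -
  have length: "length gs = k - 1" if "gs \<in> rainbow_gaps k (b - a)" for gs
    using that unfolding rainbow_gaps_def by simp
  have "num_dissections k a b = card (SIGMA gs:gap_sequences (colorful k) a b.
      \<Pi>\<^sub>E i\<in>{..<length gs}. dissections (colorful k) (vertices a gs i) (vertices a gs (Suc i)))"
    unfolding num_dissections_def using bij_betw_same_card[OF bij_betw_glue_dissections[OF ab]] by metis
  also have "gap_sequences (colorful k) a b = rainbow_gaps k (b - a)"
    using ab unfolding gap_sequences_colorful[OF k] by (auto simp: rainbow_gaps_def)
  also have "card (SIGMA gs:rainbow_gaps k (b - a).
      \<Pi>\<^sub>E i\<in>{..<length gs}. dissections (colorful k) (vertices a gs i) (vertices a gs (Suc i)))
    = (\<Sum>gs\<in>rainbow_gaps k (b - a). \<Prod>i<k - 1. num_dissections k (vertices a gs i) (vertices a gs (Suc i)))"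
    by (subst card_SigmaI)
       (auto simp: finite_rainbow_gaps finite_dissections card_PiE num_dissections_def length
         intro!: finite_PiE)
  finally show ?thesis .
qed

lemma num_dissections_edge: "num_dissections k a (Suc a) = 1"
proof -
  have "{(u, v). a \<le> u \<and> u < v \<and> v \<le> Suc a} = {(a, Suc a)}"
    by auto
  then have "chord_systems a (Suc a) = {{(a, Suc a)}}"
    unfolding chord_systems_def by (auto simp: subset_singleton_iff)
  moreover have "W \<notin> faces {(a, Suc a)}" for W
  proof
    assume W: "W \<in> faces {(a, Suc a)}"
    have "W \<subseteq> {a, Suc a}"
      using face_base(1,4)[OF W] by auto
    then have "card W \<le> card {a, Suc a}" by (intro card_mono) auto
    then show False using faceD(2)[OF W] by simp
  qed
  ultimately have "dissections (colorful k) a (Suc a) = {{(a, Suc a)}}"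
    unfolding dissections_def by auto
  then show ?thesis unfolding num_dissections_def by simp
qed

lemma rainbow_gap_bounds:
  assumes "gs \<in> rainbow_gaps k g" "3 \<le> k" "i < k - 1"
  shows "0 < gs ! i" "gs ! i < g"
proof -
  have len: "length gs = k - 1" and pos: "0 \<notin> set gs" and sum: "sum_list gs = g"
    using assms unfolding rainbow_gaps_def by auto
  have nz: "0 < gs ! j" if "j < k - 1" for j
    using pos that len by (metis gr0I nth_mem)
  define j where "j = (if i = 0 then 1 else 0 :: nat)"
  have j: "j < k - 1" "j \<noteq> i"
    using assms(2,3) unfolding j_def by auto
  have "gs ! i + gs ! j = (\<Sum>l\<in>{i, j}. gs ! l)" using j by simp
  also have "\<dots> \<le> (\<Sum>l<k - 1. gs ! l)"
    using j assms(3) by (intro sum_mono2) auto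
  also have "\<dots> = g"
    using sum len by (simp add: sum_list_sum_nth atLeast0LessThan)
  finally show "gs ! i < g" using nz[OF j(1)] by simp
  show "0 < gs ! i" using nz assms(3) by blast
qed

text \<open>
  The recursion mentions the start of the path only through the counts of the parts, so invariance under
  translation follows by induction on the gap and no dissection has to be moved.
\<close>

lemma num_dissections_shift:
  assumes k: "3 \<le> k" and "a < b"
  shows "num_dissections k a b = num_dissections k 0 (b - a)"
  using assms(2)
proof (induction "b - a" arbitrary: a b rule: less_induct)
  case less
  show ?case
  proof (cases "b = Suc a")
    case True
    then show ?thesis using num_dissections_edge[of k a] num_dissections_edge[of k 0] by simp
  next
    case False
    then have ab: "Suc a < b" using less.prems by simp
    have step: "num_dissections k (vertices c gs i) (vertices c gs (Suc i)) = num_dissections k 0 (gs ! i)"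
      if "gs \<in> rainbow_gaps k (b - a)" "i < k - 1" for c gs i
      using less.hyps[of "vertices c gs (Suc i)" "vertices c gs i"] rainbow_gap_bounds[OF that(1) k that(2)] that
      by (simp add: vertices_Suc rainbow_gaps_def)
    have "num_dissections k a b = (\<Sum>gs\<in>rainbow_gaps k (b - a). \<Prod>i<k - 1. num_dissections k 0 (gs ! i))"
      unfolding num_dissections_rec[OF k ab] using step by simp
    also have "\<dots> = num_dissections k 0 (b - a)"
      using num_dissections_rec[OF k, of 0 "b - a"] ab step by simp
    finally show ?thesis .
  qed
qed

lemma num_dissections_0_rec:
  assumes k: "3 \<le> k" and g: "1 < g"
  shows "num_dissections k 0 g = (\<Sum>gs\<in>rainbow_gaps k g. \<Prod>i<k - 1. num_dissections k 0 (gs ! i))"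
proof -
  have "num_dissections k (vertices 0 gs i) (vertices 0 gs (Suc i)) = num_dissections k 0 (gs ! i)"
    if "gs \<in> rainbow_gaps k g" "i < k - 1" for gs i
    using num_dissections_shift[OF k, of "vertices 0 gs i" "vertices 0 gs (Suc i)"]
      rainbow_gap_bounds[OF that(1) k that(2)] that
    by (simp add: vertices_Suc rainbow_gaps_def)
  then show ?thesis using num_dissections_rec[OF k, of 0 g] g by simp
qed

section \<open>From partitions of a polygon to chord systems\<close>

definition drawn_segments :: "nat \<Rightarrow> nat set set \<Rightarrow> (nat \<times> nat) set" where
  "drawn_segments N D = {(u, v). u < v \<and> v \<le> Suc N \<and> {u, v} \<in> sides {..<N + 2} \<union> D}"

lemma pair_in_sides_iff:
  assumes "u < v"
  shows "{u, v} \<in> sides W \<longleftrightarrow> u \<in> W \<and> v \<in> W \<and> is_side W u v"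
proof
  assume "{u, v} \<in> sides W"
  then obtain a b where "{u, v} = {a, b}" "a \<in> W" "b \<in> W" "a < b" "is_side W a b"
    unfolding sides_def is_side_def by blast
  moreover from this have "u = a" "v = b" using assms by (auto simp: doubleton_eq_iff)
  ultimately show "u \<in> W \<and> v \<in> W \<and> is_side W u v" by simp
next
  assume "u \<in> W \<and> v \<in> W \<and> is_side W u v"
  then show "{u, v} \<in> sides W"
    unfolding sides_def is_side_def using assms by blast
qed

lemma pair_in_diagonals_iff:
  assumes "u < v"
  shows "{u, v} \<in> diagonals W \<longleftrightarrow> u \<in> W \<and> v \<in> W \<and> \<not> is_side W u v"
proof -
  have "{u, v} \<in> {{a, b} | a b. a \<in> W \<and> b \<in> W \<and> a \<noteq> b} \<longleftrightarrow> u \<in> W \<and> v \<in> W"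
    using assms by (auto simp: doubleton_eq_iff)
  then show ?thesis
    unfolding diagonals_def using pair_in_sides_iff[OF assms] by blast
qed

lemma is_side_polygon_iff:
  assumes "u < v" "v \<le> Suc N"
  shows "is_side {..<N + 2} u v \<longleftrightarrow> v = Suc u \<or> u = 0 \<and> v = Suc N"
proof -
  have "(\<forall>w\<in>{..<N + 2}. \<not> (u < w \<and> w < v)) \<longleftrightarrow> v = Suc u"
  proof
    assume "\<forall>w\<in>{..<N + 2}. \<not> (u < w \<and> w < v)"
    then have "\<not> (Suc u < v)" using assms by auto
    then show "v = Suc u" using assms by simp
  qed auto
  moreover have "(\<forall>w\<in>{..<N + 2}. u \<le> w \<and> w \<le> v) \<longleftrightarrow> u = 0 \<and> v = Suc N"
  proof
    assume *: "\<forall>w\<in>{..<N + 2}. u \<le> w \<and> w \<le> v"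
    have "u \<le> 0" "Suc N \<le> v" using *[rule_format, of 0] *[rule_format, of "Suc N"] by auto
    then show "u = 0 \<and> v = Suc N" using assms by simp
  qed auto
  ultimately show ?thesis unfolding is_side_def by simp
qed

lemma in_drawn_segments_iff:
  assumes "u < v" "v \<le> Suc N"
  shows "(u, v) \<in> drawn_segments N D \<longleftrightarrow> v = Suc u \<or> u = 0 \<and> v = Suc N \<or> {u, v} \<in> D"
  using assms pair_in_sides_iff[OF assms(1), of "{..<N + 2}"] is_side_polygon_iff[OF assms]
  unfolding drawn_segments_def by auto

lemma drawn_segments_bounds: "(u, v) \<in> drawn_segments N D \<Longrightarrow> u < v \<and> v \<le> Suc N"
  unfolding drawn_segments_def by simp

lemma diagonal_obtain:
  assumes "e \<in> diagonals W"
  obtains u v where "e = {u, v}" "u < v" "u \<in> W" "v \<in> W" "\<not> is_side W u v"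
proof -
  obtain a b where ab: "e = {a, b}" "a \<in> W" "b \<in> W" "a \<noteq> b"
    using assms unfolding diagonals_def by blast
  have "e = {min a b, max a b}" "min a b < max a b"
    using ab by (auto simp: min_def max_def)
  then obtain u v where "e = {u, v}" "u < v" by blast
  then show ?thesis using that assms pair_in_diagonals_iff[of u v W] by simp
qed

lemma drawn_segments_sides_diagonals:
  assumes "D \<subseteq> diagonals {..<N + 2}"
  shows "{{u, v} | u v. (u, v) \<in> drawn_segments N D} - sides {..<N + 2} = D"
proof (intro equalityI subsetI)
  fix e assume e: "e \<in> D"
  then have "e \<in> diagonals {..<N + 2}" using assms by blast
  then obtain u v where uv: "e = {u, v}" "u < v" "v < N + 2" "\<not> is_side {..<N + 2} u v"
    by (elim diagonal_obtain) auto
  then have "(u, v) \<in> drawn_segments N D" "e \<notin> sides {..<N + 2}"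
    using e by (auto simp: drawn_segments_def pair_in_sides_iff)
  then show "e \<in> {{u, v} | u v. (u, v) \<in> drawn_segments N D} - sides {..<N + 2}"
    using uv by blast
qed (auto simp: drawn_segments_def)

text \<open>
  The two notions treat the sides of the big polygon differently, but such a side with both ends in \<open>W\<close>
  is always a side of \<open>W\<close>, so it never counts as a diagonal.
\<close>

lemma regions_eq_faces:
  assumes D: "D \<subseteq> diagonals {..<N + 2}"
  shows "regions (N + 2) D = faces (drawn_segments N D)"
proof (intro equalityI subsetI)
  fix W assume W: "W \<in> regions (N + 2) D"
  then have sub: "W \<subseteq> {..<N + 2}" and card: "3 \<le> card W"
    and sides: "sides W \<subseteq> sides {..<N + 2} \<union> D" and diag: "diagonals W \<inter> D = {}"
    unfolding regions_def by auto
  have "(u, v) \<in> drawn_segments N D \<longleftrightarrow> is_side W u v" if uv: "u \<in> W" "v \<in> W" "u < v" for u v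
  proof
    assume "is_side W u v"
    then have "{u, v} \<in> sides W" using uv pair_in_sides_iff by simp
    then show "(u, v) \<in> drawn_segments N D"
      using sides uv sub unfolding drawn_segments_def by auto
  next
    assume "(u, v) \<in> drawn_segments N D"
    then consider "{u, v} \<in> sides {..<N + 2}" | "{u, v} \<in> D" unfolding drawn_segments_def by blast
    then show "is_side W u v"
    proof cases
      case 1
      then show ?thesis using uv(3) sub unfolding pair_in_sides_iff[OF uv(3)] is_side_def by blast
    next
      case 2
      then have "{u, v} \<notin> diagonals W" using diag by blast
      then show ?thesis using uv pair_in_diagonals_iff by simp
    qed
  qed
  then show "W \<in> faces (drawn_segments N D)"
    unfolding faces_def using card finite_subset[OF sub] by blast
next
  fix W assume W: "W \<in> faces (drawn_segments N D)"
  have sub: "W \<subseteq> {..<N + 2}"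
    using face_base(1,4)[OF W] drawn_segments_bounds[of "Min W" "Max W" N D] by auto
  have "sides W \<subseteq> sides {..<N + 2} \<union> D"
  proof
    fix e assume e: "e \<in> sides W"
    then obtain u v where uv: "e = {u, v}" "u < v" unfolding sides_def by blast
    then have "u \<in> W" "v \<in> W" "is_side W u v" using e pair_in_sides_iff by auto
    then have "(u, v) \<in> drawn_segments N D" using face_side[OF W] uv by blast
    then show "e \<in> sides {..<N + 2} \<union> D" using uv unfolding drawn_segments_def by simp
  qed
  moreover have "e \<notin> D" if e: "e \<in> diagonals W" for e
  proof
    assume "e \<in> D"
    obtain u v where uv: "e = {u, v}" "u < v" "u \<in> W" "v \<in> W" "\<not> is_side W u v"
      using diagonal_obtain[OF e] by blast
    then have "(u, v) \<in> drawn_segments N D"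
      using \<open>e \<in> D\<close> sub unfolding drawn_segments_def by auto
    then show False using face_side[OF W] uv by blast
  qed
  ultimately show "W \<in> regions (N + 2) D"
    unfolding regions_def using faceD[OF W] sub by blast
qed

text \<open>
  Adding the sides of the polygon creates no crossing, since all other vertices are on one side of them.
\<close>

lemma drawn_segments_chord_system_iff:
  assumes D: "D \<subseteq> diagonals {..<N + 2}"
  shows "drawn_segments N D \<in> chord_systems 0 (Suc N) \<longleftrightarrow> (\<forall>e\<in>D. \<forall>f\<in>D. \<not> crossing e f)"
proof
  assume cs: "drawn_segments N D \<in> chord_systems 0 (Suc N)"
  have in_drawn: "(u, v) \<in> drawn_segments N D" if "{u, v} \<in> D" "u < v" for u v
  proof -
    have "{u, v} \<in> diagonals {..<N + 2}" using that D by blast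
    then have "v < N + 2" using pair_in_diagonals_iff[OF that(2)] by simp
    then show ?thesis using that unfolding drawn_segments_def by simp
  qed
  show "\<forall>e\<in>D. \<forall>f\<in>D. \<not> crossing e f"
  proof (intro ballI notI)
    fix e f assume ef: "e \<in> D" "f \<in> D" "crossing e f"
    then obtain a b c d where abcd: "a < c" "c < b" "b < d" "{a, b} \<in> D" "{c, d} \<in> D"
      unfolding crossing_def by blast
    then show False
      using chord_systemsD(4)[OF cs in_drawn[of a b] in_drawn[of c d]] by simp
  qed
next
  assume nc: "\<forall>e\<in>D. \<forall>f\<in>D. \<not> crossing e f"
  have False
    if uv: "(u, v) \<in> drawn_segments N D" and xy: "(x, y) \<in> drawn_segments N D"
      and cross: "u < x" "x < v" "v < y" for u v x y
  proof -
    have b: "u < v" "v \<le> Suc N" "x < y" "y \<le> Suc N"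
      using drawn_segments_bounds[OF uv] drawn_segments_bounds[OF xy] by auto
    have "{u, v} \<in> D" "{x, y} \<in> D"
      using uv xy b cross in_drawn_segments_iff[of u v N D] in_drawn_segments_iff[of x y N D] by auto
    moreover have "crossing {u, v} {x, y}" unfolding crossing_def using cross by blast
    ultimately show False using nc by blast
  qed
  moreover have "(0, Suc N) \<in> drawn_segments N D" "\<And>u. u < Suc N \<Longrightarrow> (u, Suc u) \<in> drawn_segments N D"
    using in_drawn_segments_iff[of _ _ N D] by auto
  ultimately show "drawn_segments N D \<in> chord_systems 0 (Suc N)"
    unfolding chord_systems_def using drawn_segments_bounds by blast
qed

lemma obtain_chord_system_diagonals:
  assumes E: "E \<in> chord_systems 0 (Suc N)"
  obtains D where "D \<subseteq> diagonals {..<N + 2}" "drawn_segments N D = E"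
proof
  let ?D = "{{u, v} | u v. (u, v) \<in> E} - sides {..<N + 2}"
  show "?D \<subseteq> diagonals {..<N + 2}"
  proof
    fix e assume "e \<in> ?D"
    then obtain u v where uv: "e = {u, v}" "(u, v) \<in> E" "e \<notin> sides {..<N + 2}" by blast
    then have "u < v" "v \<le> Suc N" using chord_systemsD(1)[OF E] by auto
    then show "e \<in> diagonals {..<N + 2}"
      using uv by (simp add: pair_in_sides_iff pair_in_diagonals_iff)
  qed
  show "drawn_segments N ?D = E"
  proof (intro equalityI subrelI)
    fix u v assume "(u, v) \<in> drawn_segments N ?D"
    then have uv: "u < v" "v \<le> Suc N" "v = Suc u \<or> u = 0 \<and> v = Suc N \<or> {u, v} \<in> ?D"
      using drawn_segments_bounds[of u v N ?D] in_drawn_segments_iff[of u v N ?D] by blast+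
    have "(u, v) \<in> E" if uv_D: "{u, v} \<in> ?D"
    proof -
      obtain x y where xy: "{u, v} = {x, y}" "(x, y) \<in> E" using uv_D by blast
      then have "x < y" using chord_systemsD(1)[OF E xy(2)] by simp
      then show ?thesis using xy uv(1) by (auto simp: doubleton_eq_iff)
    qed
    then show "(u, v) \<in> E"
      using uv chord_systemsD(2)[OF E] chord_systemsD(3)[OF E, of u] by (elim disjE) simp_all
  next
    fix u v assume uv: "(u, v) \<in> E"
    then have "{u, v} \<in> {{u, v} | u v. (u, v) \<in> E}" by blast
    then have "{u, v} \<in> sides {..<N + 2} \<union> ?D" by simp
    moreover have "u < v" "v \<le> Suc N"
      using chord_systemsD(1)[OF E uv] by simp_all
    ultimately show "(u, v) \<in> drawn_segments N ?D"
      unfolding drawn_segments_def by simp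
  qed
qed

lemma num_proper_partitions_eq: "num_proper_partitions k N = num_dissections k 0 (Suc N)"
proof -
  have proper: "proper_k_partition k (N + 2) D \<longleftrightarrow>
      D \<subseteq> diagonals {..<N + 2} \<and> drawn_segments N D \<in> dissections (colorful k) 0 (Suc N)" for D
  proof (cases "D \<subseteq> diagonals {..<N + 2}")
    case True
    then show ?thesis
      unfolding proper_k_partition_def k_partition_def dissections_def colorful_def
        regions_eq_faces[OF True] mem_Collect_eq drawn_segments_chord_system_iff[OF True]
      by blast
  qed (auto simp: proper_k_partition_def k_partition_def)
  have "bij_betw (drawn_segments N) {D. proper_k_partition k (N + 2) D} (dissections (colorful k) 0 (Suc N))"
  proof (rule bij_betw_imageI)
    show "inj_on (drawn_segments N) {D. proper_k_partition k (N + 2) D}"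
    proof (rule inj_onI)
      fix D D'
      assume "D \<in> {D. proper_k_partition k (N + 2) D}" "D' \<in> {D. proper_k_partition k (N + 2) D}"
        and eq: "drawn_segments N D = drawn_segments N D'"
      then have D: "D \<subseteq> diagonals {..<N + 2}" "D' \<subseteq> diagonals {..<N + 2}"
        by (simp_all only: mem_Collect_eq proper)
      show "D = D'"
        using drawn_segments_sides_diagonals[OF D(1)] drawn_segments_sides_diagonals[OF D(2)]
        unfolding eq by simp
    qed
    show "drawn_segments N ` {D. proper_k_partition k (N + 2) D} = dissections (colorful k) 0 (Suc N)"
    proof (intro equalityI subsetI)
      fix E assume E: "E \<in> dissections (colorful k) 0 (Suc N)"
      then obtain D where "D \<subseteq> diagonals {..<N + 2}" "drawn_segments N D = E"
        using obtain_chord_system_diagonals[of E N] unfolding dissections_def by blast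
      then show "E \<in> drawn_segments N ` {D. proper_k_partition k (N + 2) D}"
        using E proper by blast
    qed (use proper in blast)
  qed
  then show ?thesis
    unfolding num_proper_partitions_def num_dissections_def by (rule bij_betw_same_card)
qed

lemma sum_list_map_affine: "sum_list (map (\<lambda>x. s * x + r) v) = s * sum_list v + length v * (r :: nat)"
  by (induction v) (auto simp: algebra_simps)

lemma mult_coprime_inj_on_mod:
  fixes r k :: nat
  assumes "coprime r k"
  shows "inj_on (\<lambda>i. i * r mod k) {..<k}"
proof (rule inj_onI)
  fix i j assume ij: "i \<in> {..<k}" "j \<in> {..<k}" "i * r mod k = j * r mod k"
  then have "int (i * r) mod int k = int (j * r) mod int k"
    by (simp only: zmod_int[symmetric])
  then have "int k dvd (int i - int j) * int r"
    by (simp add: mod_eq_dvd_iff left_diff_distrib)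
  then have "int k dvd int i - int j"
    using assms by (simp add: coprime_dvd_mult_left_iff coprime_commute)
  then have "int i mod int k = int j mod int k"
    by (simp add: mod_eq_dvd_iff)
  then show "i = j" using ij by simp
qed

section \<open>Which gaps contribute\<close>

text \<open>
  The number of vertices of a polygon that is cut into \<open>j\<close> \<open>k\<close>-gons is \<open>(k - 2) j + 2\<close>, and \<open>j\<close> turns out to
  matter modulo \<open>k\<close>. Gaps are therefore written in the form \<open>period k * x + r\<close>, where \<open>r = 1\<close> belongs to
  \<open>j \<equiv> 0\<close> and \<open>r = k - 1\<close> to \<open>j \<equiv> 1\<close> modulo \<open>k\<close>.
\<close>

definition period :: "nat \<Rightarrow> nat" where
  "period k = (k - 2) * k"

definition count_fps :: "nat \<Rightarrow> nat \<Rightarrow> real fps" where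
  "count_fps k r = Abs_fps (\<lambda>n. real (num_dissections k 0 (period k * n + r)))"

context
  fixes k :: nat
  assumes k: "3 \<le> k"
begin

lemma period_pos: "0 < period k" and k_dvd_period: "k dvd period k"
  using k by (auto simp: period_def)

lemma affine_mod: "(period k * x + r) mod k = r mod k"
  using k_dvd_period by (metis dvd_mult2 mod_0 mod_add_left_eq add_0 dvd_imp_mod_0)

lemma square_pred: "(k - 1) * (k - 1) = period k + 1"
proof -
  have "k = (k - 2) + 2" using k by simp
  then obtain l where "k = l + 2" by blast
  then show ?thesis unfolding period_def by (simp add: algebra_simps)
qed

lemma residue_in: "r \<in> {1, k - 1} \<Longrightarrow> 0 < r \<and> r < k \<and> coprime r k"
  using k coprime_diff_one_left_nat[of k] by auto

text \<open>
  Equal steps \<open>r\<close> coprime to \<open>k\<close> visit each residue once, so the coloring puts no restriction on gaps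
  that all have the same residue \<open>1\<close> or \<open>-1\<close>.
\<close>

lemma map_affine_rainbow_gaps:
  assumes r: "r \<in> {1, k - 1}" and v: "length v = k - 1"
  shows "map (\<lambda>x. period k * x + r) v \<in> rainbow_gaps k (period k * sum_list v + (k - 1) * r)"
proof -
  have "sum_list (take i (map (\<lambda>x. period k * x + r) v)) mod k = i * r mod k" if "i < k" for i
    using that v by (simp add: take_map sum_list_map_affine affine_mod)
  then have "inj_on (\<lambda>i. sum_list (take i (map (\<lambda>x. period k * x + r) v)) mod k) {..<k} \<longleftrightarrow>
      inj_on (\<lambda>i. i * r mod k) {..<k}"
    by (intro inj_on_cong) auto
  then show ?thesis
    using mult_coprime_inj_on_mod[of r k] residue_in[OF r] v
    unfolding rainbow_gaps_def by (auto simp: sum_list_map_affine)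
qed

text \<open>
  Two consecutive gaps with different residues among \<open>1\<close> and \<open>-1\<close> would return to the color before them.
\<close>

lemma rainbow_gaps_uniform:
  assumes gs: "gs \<in> rainbow_gaps k g"
    and types: "\<And>i. i < k - 1 \<Longrightarrow> \<exists>x. \<exists>r\<in>{1, k - 1}. gs ! i = period k * x + r"
  obtains r v where "r \<in> {1, k - 1}" "length v = k - 1" "gs = map (\<lambda>x. period k * x + r) v"
proof -
  have len: "length gs = k - 1"
    and inj: "inj_on (\<lambda>i. sum_list (take i gs) mod k) {..<k}"
    using gs unfolding rainbow_gaps_def by auto
  have mods: "gs ! i mod k \<in> {1, k - 1}" if i: "i < k - 1" for i
  proof -
    obtain x r where "r \<in> {1, k - 1}" "gs ! i = period k * x + r" using types[OF i] by blast
    then show ?thesis using residue_in[of r] by (simp only: affine_mod mod_less)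
  qed
  have step: "gs ! Suc i mod k = gs ! i mod k" if i: "Suc i < k - 1" for i
  proof (rule ccontr)
    assume "gs ! Suc i mod k \<noteq> gs ! i mod k"
    then have "gs ! i mod k + gs ! Suc i mod k = k"
      using mods[of i] mods[of "Suc i"] i k by auto
    then have "(gs ! i + gs ! Suc i) mod k = 0"
      by (metis mod_add_eq mod_self)
    moreover have "sum_list (take (Suc (Suc i)) gs) = sum_list (take i gs) + (gs ! i + gs ! Suc i)"
      using i len by (simp add: take_Suc_conv_app_nth)
    ultimately have "sum_list (take (Suc (Suc i)) gs) mod k = sum_list (take i gs) mod k"
      by (metis add.right_neutral mod_add_right_eq)
    then have "Suc (Suc i) = i"
      using inj_onD[OF inj, of "Suc (Suc i)" i] i by (simp add: less_diff_conv)
    then show False by simp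
  qed
  define r where "r = gs ! 0 mod k"
  have r: "r \<in> {1, k - 1}" unfolding r_def using mods k by simp
  have all: "gs ! i mod k = r" if "i < k - 1" for i
    using that
  proof (induction i)
    case (Suc i)
    then show ?case using step[of i] by simp
  qed (simp add: r_def)
  have "\<exists>x. gs ! i = period k * x + r" if i: "i < k - 1" for i
  proof -
    obtain x r' where x: "r' \<in> {1, k - 1}" "gs ! i = period k * x + r'" using types[OF i] by blast
    then have "r' = r" using all[OF i] residue_in[OF x(1)] by (simp add: affine_mod)
    then show ?thesis using x by blast
  qed
  then obtain h where h: "\<And>i. i < k - 1 \<Longrightarrow> gs ! i = period k * h i + r" by metis
  show ?thesis
  proof (rule that[OF r])
    show "gs = map (\<lambda>x. period k * x + r) (map h [0..<k - 1])"
      using h len by (intro nth_equalityI) auto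
  qed simp
qed

text \<open>
  Gaps \<open>r = 1\<close> add up to a gap of residue \<open>k - 1\<close>; gaps \<open>r = k - 1\<close> add up to a gap of residue \<open>1\<close>, where
  \<open>(k - 1)\<^sup>2\<close> makes up one more period.
\<close>

lemma num_dissections_support:
  assumes "num_dissections k 0 g \<noteq> 0" "0 < g"
  shows "\<exists>x. \<exists>r\<in>{1, k - 1}. g = period k * x + r"
  using assms
proof (induction g rule: less_induct)
  case (less g)
  show ?case
  proof (cases "g = 1")
    case True
    then have "g = period k * 0 + 1" by simp
    then show ?thesis by blast
  next
    case False
    then have "1 < g" using less.prems by simp
    then obtain gs where gs: "gs \<in> rainbow_gaps k g" and nz: "(\<Prod>i<k - 1. num_dissections k 0 (gs ! i)) \<noteq> 0"
      using less.prems num_dissections_0_rec[OF k, of g] by (metis (mono_tags, lifting) sum.neutral)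
    have "\<exists>x. \<exists>r\<in>{1, k - 1}. gs ! i = period k * x + r" if "i < k - 1" for i
    proof (rule less.IH)
      show "num_dissections k 0 (gs ! i) \<noteq> 0" using nz that by simp
    qed (use rainbow_gap_bounds[OF gs k that] in auto)
    then obtain r v where rv: "r \<in> {1, k - 1}" "length v = k - 1" "gs = map (\<lambda>x. period k * x + r) v"
      using rainbow_gaps_uniform[OF gs] by metis
    then have g: "g = period k * sum_list v + (k - 1) * r"
      using gs by (simp add: rainbow_gaps_def sum_list_map_affine)
    show ?thesis
    proof (cases "r = 1")
      case True
      then show ?thesis using g by auto
    next
      case False
      then have "g = period k * Suc (sum_list v) + 1"
        using g rv(1) square_pred by simp
      then show ?thesis by blast
    qed
  qed
qed

text \<open>
  The sum of the gaps determines their common residue \<open>r\<close> modulo \<open>k\<close>, as it is congruent to \<open>-r\<close> and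
  \<open>1\<close> and \<open>-1\<close> are different modulo \<open>k \<ge> 3\<close>. So one of the two kinds of terms survives in the recursion.
\<close>

lemma num_dissections_convolution:
  assumes r: "r \<in> {1, k - 1}"
  shows "num_dissections k 0 (period k * n + (k - 1) * r) =
    (\<Sum>v\<in>natpermute n (k - 1). \<Prod>i<k - 1. num_dissections k 0 (period k * v ! i + r))"
proof -
  let ?g = "period k * n + (k - 1) * r"
  let ?h = "map (\<lambda>x. period k * x + r)"
  have "2 * 1 \<le> (k - 1) * r" using k residue_in[OF r] by (intro mult_le_mono) auto
  then have "1 < ?g" by simp
  then have "num_dissections k 0 ?g = (\<Sum>gs\<in>rainbow_gaps k ?g. \<Prod>i<k - 1. num_dissections k 0 (gs ! i))"
    by (rule num_dissections_0_rec[OF k])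
  also have "\<dots> = (\<Sum>gs\<in>?h ` natpermute n (k - 1). \<Prod>i<k - 1. num_dissections k 0 (gs ! i))"
  proof (rule sum.mono_neutral_right[OF finite_rainbow_gaps])
    show "?h ` natpermute n (k - 1) \<subseteq> rainbow_gaps k ?g"
      using map_affine_rainbow_gaps[OF r] by (auto simp: natpermute_def)
    show "\<forall>gs\<in>rainbow_gaps k ?g - ?h ` natpermute n (k - 1). (\<Prod>i<k - 1. num_dissections k 0 (gs ! i)) = 0"
    proof (intro ballI, rule ccontr)
      fix gs assume gs: "gs \<in> rainbow_gaps k ?g - ?h ` natpermute n (k - 1)"
        and nz: "(\<Prod>i<k - 1. num_dissections k 0 (gs ! i)) \<noteq> 0"
      then have gs': "gs \<in> rainbow_gaps k ?g" by simp
      have "\<exists>x. \<exists>r\<in>{1, k - 1}. gs ! i = period k * x + r" if "i < k - 1" for i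
        by (rule num_dissections_support) (use nz that rainbow_gap_bounds[OF gs' k that] in auto)
      then obtain r' v where rv: "r' \<in> {1, k - 1}" "length v = k - 1" "gs = map (\<lambda>x. period k * x + r') v"
        using rainbow_gaps_uniform[OF gs'] by metis
      then have sum: "?g = period k * sum_list v + (k - 1) * r'"
        using gs' by (simp add: rainbow_gaps_def sum_list_map_affine)
      have res: "(period k * x + (k - 1) * r) mod k = (if r = 1 then k - 1 else 1)" if "r \<in> {1, k - 1}" for x r
      proof -
        have "(period k * x + (k - 1) * (k - 1)) mod k = 1"
          using affine_mod[of "Suc x" 1] k square_pred by (simp add: algebra_simps)
        moreover have "(period k * x + (k - 1) * 1) mod k = k - 1"
          using affine_mod[of x "k - 1"] k by simp
        ultimately show ?thesis using that by auto
      qed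
      have "(if r = 1 then k - 1 else 1) = (if r' = 1 then k - 1 else 1)"
        using res[OF r, of n] res[OF rv(1), of "sum_list v"] unfolding sum by (rule trans[OF sym])
      moreover have "k - 1 \<noteq> 1" using k by simp
      ultimately have "r' = r" using r rv(1) by (auto simp del: One_nat_def split: if_splits)
      then have "sum_list v = n" using sum period_pos by simp
      then have "gs \<in> ?h ` natpermute n (k - 1)"
        using rv \<open>r' = r\<close> by (auto simp: natpermute_def)
      then show False using gs by simp
    qed
  qed
  also have "\<dots> = (\<Sum>v\<in>natpermute n (k - 1). \<Prod>i<k - 1. num_dissections k 0 (?h v ! i))"
  proof (subst sum.reindex)
    have "inj (\<lambda>x. period k * x + r)" using period_pos by (simp add: inj_def)
    then show "inj_on ?h (natpermute n (k - 1))"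
      by (metis inj_mapI inj_on_subset subset_UNIV)
  qed simp
  also have "\<dots> = (\<Sum>v\<in>natpermute n (k - 1). \<Prod>i<k - 1. num_dissections k 0 (period k * v ! i + r))"
    by (intro sum.cong prod.cong refl) (auto simp: natpermute_def)
  finally show ?thesis .
qed

text \<open>Taking the power \<open>k - 1\<close> exchanges the two residues.\<close>

lemma count_fps_power:
  assumes "r \<in> {1, k - 1}"
  shows "fps_nth (count_fps k r ^ (k - 1)) n = real (num_dissections k 0 (period k * n + (k - 1) * r))"
proof -
  have "{0..k - 1 - 1} = {..<k - 1}" using k by auto
  then show ?thesis
    using k unfolding num_dissections_convolution[OF assms]
    by (simp add: fps_power_nth count_fps_def)
qed

lemma count_fps_pred: "count_fps k (k - 1) = count_fps k 1 ^ (k - 1)"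
proof (rule fps_ext)
  show "fps_nth (count_fps k (k - 1)) n = fps_nth (count_fps k 1 ^ (k - 1)) n" for n
    unfolding count_fps_power[OF insertI1] by (simp add: count_fps_def)
qed

lemma count_fps_one: "count_fps k 1 = 1 + fps_X * count_fps k 1 ^ ((k - 1)\<^sup>2)"
proof -
  have "count_fps k 1 = 1 + fps_X * count_fps k (k - 1) ^ (k - 1)"
  proof (rule fps_ext)
    fix n
    show "fps_nth (count_fps k 1) n = fps_nth (1 + fps_X * count_fps k (k - 1) ^ (k - 1)) n"
    proof (cases n)
      case 0
      then show ?thesis using num_dissections_edge[of k 0] by (simp add: count_fps_def)
    next
      case (Suc m)
      have "fps_nth (count_fps k (k - 1) ^ (k - 1)) m = fps_nth (count_fps k 1) (Suc m)"
        unfolding count_fps_power[OF insertI2[OF singletonI]] square_pred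
        by (simp add: count_fps_def algebra_simps)
      then show ?thesis
        using Suc by simp
    qed
  qed
  then show ?thesis
    unfolding count_fps_pred power2_eq_square power_mult .
qed

end

section \<open>Powers of a solution of \<open>A = 1 + x A ^ m\<close>\<close>

text \<open>
  Every term is a multiple of one binomial coefficient \<open>x\<close> choose \<open>y\<close>, where \<open>x = m y + d\<close> and \<open>y = n + 1\<close>. After
  division by it, the claim is the identity \<open>(d + 1) x = d (x - y + 1) + (m + d) y\<close>.
\<close>

lemma Catalan_Suc:
  assumes "m \<ge> 2"
  shows "Catalan (Suc n) m (Suc d) = Catalan (Suc n) m d + Catalan n m (m + d)"
proof -
  define N where "N = m * Suc n + d - 1"
  have big: "2 * Suc n \<le> m * Suc n"
    using assms by (rule mult_le_mono1)
  have N: "Suc N = m * Suc n + d" and n_less: "Suc n < Suc N"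
    using big unfolding N_def by auto
  have arg: "m * n + (m + d) - 1 = N"
    unfolding N_def by simp
  have Nr: "real m * real (Suc n) + real d = real N + 1"
    using arg_cong[OF N, of real] by (simp add: algebra_simps)
  define c where "c = real (Suc N choose Suc n)"
  define x where "x = real N + 1"
  define y where "y = real n + 1"
  have xy: "x > y" "y > 0"
    using n_less unfolding x_def y_def by auto
  have absorb: "real (N choose n) = y / x * c"
  proof -
    have "real (Suc n * (Suc N choose Suc n)) = real (Suc N * (N choose n))"
      by (simp only: Suc_times_binomial)
    then show ?thesis
      using xy unfolding c_def x_def y_def by (simp add: field_simps)
  qed
  have pascal: "c = real (N choose n) + real (N choose Suc n)"
    unfolding c_def by simp
  have comp: "real (N choose Suc n) = (x - y) / x * c"
    using pascal absorb xy by (simp add: field_simps)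
  have mn: "real m * y = x - real d"
    using Nr unfolding x_def y_def by (simp add: algebra_simps)
  have d1: "(real m - 1) * real (Suc n) + real (Suc d) = x - y + 1"
    using Nr unfolding x_def y_def by (simp add: algebra_simps)
  have d2: "(real m - 1) * real (Suc n) + real d = x - y"
    using Nr unfolding x_def y_def by (simp add: algebra_simps)
  have d3: "(real m - 1) * real n + real (m + d) = x - y + 1"
    using Nr unfolding x_def y_def by (simp add: algebra_simps)
  have "Catalan (Suc n) m (Suc d) = (real d + 1) / (x - y + 1) * c"
    unfolding Catalan_def d1 c_def N[symmetric] using N by (simp add: add.commute)
  moreover have "Catalan (Suc n) m d = real d / (x - y) * ((x - y) / x * c)"
    unfolding Catalan_def d2 comp[symmetric] N_def by simp
  moreover have "Catalan n m (m + d) = (real m + real d) / (x - y + 1) * (y / x * c)"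
    unfolding Catalan_def d3 arg absorb by simp
  moreover have "real d / (x - y) * ((x - y) / x * c) = real d / x * c"
    using xy by simp
  moreover have "(real d + 1) / z = real d / x + (real m + real d) / z * (y / x)"
    if z: "z = x - y + 1" for z
  proof -
    have "z > 0" using z xy by simp
    then have "real d / x + (real m + real d) / z * (y / x) = (real d * z + (real m + real d) * y) / (z * x)"
      using xy by (simp add: field_simps)
    also have "real d * z + (real m + real d) * y = (real d + 1) * x"
      using mn unfolding z by (simp add: algebra_simps)
    finally show ?thesis using xy by simp
  qed
  from this[OF refl] have "(real d + 1) / (x - y + 1) * c
      = real d / x * c + (real m + real d) / (x - y + 1) * (y / x * c)"
    by (simp add: distrib_right)
  ultimately show ?thesis by (simp only:)
qed

text \<open>
  Comparing all powers of \<open>A\<close> at once replaces Lagrange inversion: \<open>A ^ (d + 1) = A ^ d + x A ^ (m + d)\<close>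
  expresses a coefficient of index \<open>n\<close> by one of a lower power and one of a lower index. The case \<open>n = d = 0\<close>
  is left out of the induction, because there \<open>Catalan\<close> has the value \<open>0\<close>.
\<close>

lemma fps_power_eq_Catalan:
  fixes A :: "real fps"
  assumes A: "A = 1 + fps_X * A ^ m" and m: "m \<ge> 2"
  shows "fps_nth (A ^ Suc d) n = Catalan n m (Suc d)"
proof -
  have step: "A ^ Suc d = A ^ d + fps_X * A ^ (m + d)" for d
  proof -
    have "A ^ Suc d = (1 + fps_X * A ^ m) * A ^ d"
      using A by simp
    then show ?thesis
      by (simp add: algebra_simps power_add)
  qed
  have "\<forall>d. (n = 0 \<longrightarrow> d > 0) \<longrightarrow> fps_nth (A ^ d) n = Catalan n m d"
  proof (induction n)
    case 0
    have "fps_nth A 0 = 1"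
      by (subst A) simp
    then show ?case
      by (simp add: Catalan_def fps_nth_power_0)
  next
    case (Suc n)
    have "fps_nth (A ^ d) (Suc n) = Catalan (Suc n) m d" for d
    proof (induction d)
      case 0
      show ?case
        by (simp add: Catalan_def)
    next
      case (Suc d)
      have "fps_nth (A ^ (m + d)) n = Catalan n m (m + d)"
        using \<open>\<forall>d. (n = 0 \<longrightarrow> d > 0) \<longrightarrow> fps_nth (A ^ d) n = Catalan n m d\<close> m by simp
      then have "fps_nth (A ^ Suc d) (Suc n) = Catalan (Suc n) m d + Catalan n m (m + d)"
        unfolding step[of d] by (simp add: Suc.IH)
      then show ?case
        by (simp only: Catalan_Suc[OF m])
    qed
    then show ?case by blast
  qed
  then show ?thesis by blast
qed

theorem theorem3p2:
  fixes k n :: nat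
  assumes "k \<ge> 4"
  shows "real (num_proper_partitions k ((k - 2) * (k * n))) = Catalan n ((k - 1)\<^sup>2) 1 \<and>
         real (num_proper_partitions k ((k - 2) * (k * n + 1))) = Catalan n ((k - 1)\<^sup>2) (k - 1)"
proof -
  have k: "3 \<le> k" using assms by simp
  have "2 * 1 \<le> (k - 1) * (k - 1)" using k by (intro mult_le_mono) auto
  then have m: "2 \<le> (k - 1)\<^sup>2" by (simp add: power2_eq_square)
  have coeff: "fps_nth (count_fps k 1 ^ Suc d) n = Catalan n ((k - 1)\<^sup>2) (Suc d)" for d
    by (rule fps_power_eq_Catalan[OF count_fps_one[OF k] m])
  have gap1: "Suc ((k - 2) * (k * n)) = period k * n + 1"
    by (simp add: period_def)
  have gap2: "Suc ((k - 2) * (k * n + 1)) = period k * n + (k - 1) * 1"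
    using k by (simp add: period_def distrib_left mult.assoc)
  have "real (num_proper_partitions k ((k - 2) * (k * n))) = fps_nth (count_fps k 1) n"
    unfolding num_proper_partitions_eq gap1 by (simp add: count_fps_def)
  moreover have "real (num_proper_partitions k ((k - 2) * (k * n + 1))) = fps_nth (count_fps k 1 ^ (k - 1)) n"
    unfolding num_proper_partitions_eq gap2 by (rule count_fps_power[OF k insertI1, symmetric])
  moreover have "fps_nth (count_fps k 1) n = Catalan n ((k - 1)\<^sup>2) 1"
    using coeff[of 0] by simp
  moreover have "fps_nth (count_fps k 1 ^ (k - 1)) n = Catalan n ((k - 1)\<^sup>2) (k - 1)"
  proof -
    have "Suc (k - 2) = k - 1" using k by simp
    then show ?thesis using coeff[of "k - 2"] by (simp only:)
  qed
  ultimately show ?thesis by (simp only:)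
qed

end
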